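(* Fix a real number $\theta>1$. Let $G=(V,E)$ be a finite connected graph with edge set $E=\{e_1,\dots,e_m\}$, and let $\mathbf{w}_0=(w_{0,e})_{e\in E}$ be an initial weight vector with $w_{0,e}>0$ for all $e\in E$. Consider the discrete Ricci curvature flow with step size $s>0$, $$w_e^{(j+1)}=\rho_e^{(j)}-s\,\kappa_e^{(j)}\rho_e^{(j)},\qquad w_e^{(j)}>0,\qquad w_e^{(0)}=w_{0,e}. \quad ( * )$$ (i) If $\kappa$ is Ollivier's Ricci curvature, then for any $0<s<1$ the flow $( * )$ has a unique global solution $(w_e^{(j)})_{j\in\mathbb{N}}$; moreover, up to $\theta$-surgeries (i.e. when $\theta$-surgery is performed at each iteration), for all $j\in\mathbb{N}$ and all edges $e$ remaining at iteration $j$, $$(1-s)^j\theta^{-j}w_{0,e}\le w_e^{(j)}\le (1+ms)^j\sum_{\tau\in E}w_{0,\tau}.$$ (ii) If $\kappa$ is Lin-Lu-Yau's Ricci curvature, then for any $0<s<1/2$ the flow $( * )$ has a unique global solution $(w_e^{(j)})_{j\in\mathbb{N}}$; moreover, up to $\theta$-surgeries, for all $j\in\mathbb{N}$ and all edges $e$ remaining at iteration $j$, $$(1-2s)^j\theta^{-j}w_{0,e}\le w_e^{(j)}\le (1+2ms)^j\sum_{\tau\in E}w_{0,\tau}.$$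
   Context: Graphs are finite, undirected, simple and connected, with at least one edge; $\mathbb{N}$ includes $0$; $m=|E|$ is the number of edges of the initial graph. For positive edge weights $\mathbf{w}=(w_e)_{e\in E}$ (write $w_{xy}=w_e$ for $e=xy$), the distance is $d(x,y)=\inf_\gamma\sum_{e\in\gamma}w_e$ over all paths $\gamma$ connecting $x$ and $y$. For an edge $e=xy$, $\rho_e=d(x,y)$ (so $\rho_e\le w_e$). For $\alpha\in[0,1]$ and $x\in V$, the $\alpha$-lazy one-step random walk is the probability measure with $\mu_x^\alpha(x)=\alpha$, $\mu_x^\alpha(z)=(1-\alpha)\,w_{xz}/\sum_{u\sim x}w_{xu}$ if $z\sim x$, and $\mu_x^\alpha(z)=0$ otherwise. For probability measures $\mu_1,\mu_2$ on $V$, the Wasserstein distance is $W(\mu_1,\mu_2)=\inf_A\sum_{u,v\in V}A(u,v)d(u,v)$ over all couplings $A:V\times V\to[0,1]$, i.e. $\sum_{x\in V}A(u,x)=\mu_1(u)$ and $\sum_{y\in V}A(y,v)=\mu_2(v)$ for all $u,v\in V$. Ollivier's Ricci curvature (for a fixed $\alpha$) on an edge $e=xy$ is $\kappa_e^\alpha=1-W(\mu_x^\alpha,\mu_y^\alpha)/\rho_e$; in statements about Ollivier's curvature, $\kappa_e=\kappa_e^\alpha$ for this fixed $\alpha$. Lin-Lu-Yau's Ricci curvature is $\kappa_e=\lim_{\alpha\to1^-}\kappa_e^\alpha/(1-\alpha)$. $\kappa_e^{(j)}$ and $\rho_e^{(j)}$ denote the curvature and the distance between the endpoints of $e$ computed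 from the weights $\mathbf{w}^{(j)}$ at iteration $j$ (both the random walks and the distance use $\mathbf{w}^{(j)}$). A global solution is a sequence of weight vectors $\mathbf{w}^{(j)}$, $j\in\mathbb{N}$, with all entries positive, satisfying the recursion and the initial condition. $\theta$-surgery on a weighted graph $(V,E,\mathbf{w})$: every edge $e$ with $w_e/\rho_e>\theta$ is removed from $E$; if there is no such edge, $E$ is unchanged. (Since $\theta>1$, removed edges lie on no shortest path, so distances and connectedness are unaffected.) The flow with $\theta$-surgery at each iteration is: put $E^{(-1)}=E$, $w_e^{(0)}=w_{0,e}$; for each $j\ge0$, let $E^{(j)}$ be the edge set obtained from $(V,E^{(j-1)},\mathbf{w}^{(j)})$ by $\theta$-surgery, compute $\rho_e^{(j)}$ and $\kappa_e^{(j)}$ on $(V,E^{(j)},(w_e^{(j)})_{e\in E^{(j)}})$, and define $w_e^{(j+1)}$ for $e\in E^{(j)}$ by the recursion. The edges remaining at iteration $j$ are those in $E^{(j)}$. *)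

theory Defs
  imports Complex_Main "HOL-Library.FuncSet"
begin

(* An edge is a two-element set of vertices; a path is given by the nonempty list of its
   (distinct) vertices, so that a single vertex is a path of length 0. *)

definition path_edges :: "'a list \<Rightarrow> 'a set list" where
  "path_edges p = map2 (\<lambda>u v. {u, v}) p (tl p)"

definition is_path :: "'a set set \<Rightarrow> 'a \<Rightarrow> 'a list \<Rightarrow> 'a \<Rightarrow> bool" where
  "is_path E x p y \<longleftrightarrow>
     p \<noteq> [] \<and> hd p = x \<and> last p = y \<and> distinct p \<and> set (path_edges p) \<subseteq> E"

definition finite_connected_graph :: "'a set \<Rightarrow> 'a set set \<Rightarrow> bool" where
  "finite_connected_graph V E \<longleftrightarrow>
     finite V \<and> (\<forall>e\<in>E. e \<subseteq> V \<and> card e = 2) \<and> (\<forall>x\<in>V. \<forall>y\<in>V. \<exists>p. is_path E x p y)"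

definition path_length :: "('a set \<Rightarrow> real) \<Rightarrow> 'a list \<Rightarrow> real" where
  "path_length w p = (\<Sum>e\<leftarrow>path_edges p. w e)"

definition path_dist :: "'a set set \<Rightarrow> ('a set \<Rightarrow> real) \<Rightarrow> 'a \<Rightarrow> 'a \<Rightarrow> real" where
  "path_dist E w x y = (INF p\<in>{p. is_path E x p y}. path_length w p)"

(* \<open>lazy_walk E w \<alpha> x z\<close> is the mass at z of the alpha-lazy one-step random walk
   started at x. *)
definition lazy_walk :: "'a set set \<Rightarrow> ('a set \<Rightarrow> real) \<Rightarrow> real \<Rightarrow> 'a \<Rightarrow> 'a \<Rightarrow> real" where
  "lazy_walk E w \<alpha> x z =
     (if z = x then \<alpha>
      else if {x, z} \<in> E then (1 - \<alpha>) * w {x, z} / (\<Sum>u | {x, u} \<in> E. w {x, u})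
      else 0)"

definition coupling :: "'a set \<Rightarrow> ('a \<Rightarrow> real) \<Rightarrow> ('a \<Rightarrow> real) \<Rightarrow> ('a \<Rightarrow> 'a \<Rightarrow> real) \<Rightarrow> bool" where
  "coupling V \<mu>1 \<mu>2 A \<longleftrightarrow>
     (\<forall>u\<in>V. \<forall>v\<in>V. A u v \<in> {0..1}) \<and>
     (\<forall>u\<in>V. (\<Sum>x\<in>V. A u x) = \<mu>1 u) \<and>
     (\<forall>v\<in>V. (\<Sum>y\<in>V. A y v) = \<mu>2 v)"

definition wasserstein ::
  "'a set \<Rightarrow> ('a \<Rightarrow> 'a \<Rightarrow> real) \<Rightarrow> ('a \<Rightarrow> real) \<Rightarrow> ('a \<Rightarrow> real) \<Rightarrow> real" where
  "wasserstein V d \<mu>1 \<mu>2 =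
     (INF A\<in>{A. coupling V \<mu>1 \<mu>2 A}. \<Sum>u\<in>V. \<Sum>v\<in>V. A u v * d u v)"

definition ollivier_curvature ::
  "'a set \<Rightarrow> real \<Rightarrow> 'a set set \<Rightarrow> ('a set \<Rightarrow> real) \<Rightarrow> 'a \<Rightarrow> 'a \<Rightarrow> real" where
  "ollivier_curvature V \<alpha> E w x y =
     1 - wasserstein V (path_dist E w) (lazy_walk E w \<alpha> x) (lazy_walk E w \<alpha> y)
           / path_dist E w x y"

definition lly_curvature ::
  "'a set \<Rightarrow> 'a set set \<Rightarrow> ('a set \<Rightarrow> real) \<Rightarrow> 'a \<Rightarrow> 'a \<Rightarrow> real" where
  "lly_curvature V E w x y =
     Lim (at_left 1) (\<lambda>\<alpha>. ollivier_curvature V \<alpha> E w x y / (1 - \<alpha>))"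

(* The value at e = {x, y} of a symmetric function of the endpoints x and y. It is only applied
   to the distance and the two curvatures, whose symmetry is proved below. *)
definition on_edge :: "('a \<Rightarrow> 'a \<Rightarrow> real) \<Rightarrow> 'a set \<Rightarrow> real" where
  "on_edge f e = (THE r. \<exists>x y. e = {x, y} \<and> r = f x y)"

lemma on_edge_doubleton:
  assumes "f x y = f y x"
  shows "on_edge f {x, y} = f x y"
  unfolding on_edge_def by (rule the_equality) (use assms in \<open>auto simp: doubleton_eq_iff\<close>)

lemma path_edges_Cons: "path_edges (x # y # p) = {x, y} # path_edges (y # p)"
  by (simp add: path_edges_def)

lemma path_edges_snoc:
  "p \<noteq> [] \<Longrightarrow> path_edges (p @ [y]) = path_edges p @ [{last p, y}]"
proof (induction p rule: induct_list012)
  case (3 a b p)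
  then show ?case by (simp add: path_edges_Cons)
qed (simp_all add: path_edges_def)

lemma path_edges_rev: "path_edges (rev p) = rev (path_edges p)"
proof (induction p rule: induct_list012)
  case (3 a b p)
  then show ?case
    using path_edges_snoc[of "rev (b # p)" a] by (simp add: path_edges_Cons insert_commute)
qed (simp_all add: path_edges_def)

lemma is_path_rev: "is_path E x p y \<Longrightarrow> is_path E y (rev p) x"
  by (auto simp: is_path_def path_edges_rev hd_rev last_rev)

lemma path_dist_sym: "path_dist E w x y = path_dist E w y x"
proof -
  have "path_length w (rev p) = path_length w p" for p
    by (simp add: path_length_def path_edges_rev rev_map[symmetric] sum_list_rev)
  moreover have "{p. is_path E y p x} = rev ` {p. is_path E x p y}"
    by (auto simp: image_iff intro: is_path_rev) (metis is_path_rev rev_rev_ident)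
  ultimately show ?thesis
    by (simp add: path_dist_def image_image)
qed

lemma wasserstein_sym:
  assumes "\<And>u v. d u v = d v u"
  shows "wasserstein V d \<mu>1 \<mu>2 = wasserstein V d \<mu>2 \<mu>1"
proof -
  have flip: "coupling V \<mu> \<nu> A \<Longrightarrow> coupling V \<nu> \<mu> (\<lambda>u v. A v u)" for \<mu> \<nu> A
    by (simp add: coupling_def)
  have couplings: "{A. coupling V \<mu>2 \<mu>1 A} = (\<lambda>A u v. A v u) ` {A. coupling V \<mu>1 \<mu>2 A}"
    by (auto simp: image_iff intro: flip)
  have cost: "(\<Sum>u\<in>V. \<Sum>v\<in>V. A v u * d u v) = (\<Sum>u\<in>V. \<Sum>v\<in>V. A u v * d u v)" for A
    by (subst sum.swap) (simp add: assms)
  show ?thesis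
    unfolding wasserstein_def couplings image_image
    by (intro arg_cong[where f = Inf] image_cong refl cost[symmetric])
qed

lemma ollivier_curvature_sym: "ollivier_curvature V \<alpha> E w x y = ollivier_curvature V \<alpha> E w y x"
  unfolding ollivier_curvature_def
  by (metis path_dist_sym wasserstein_sym)

lemma lly_curvature_sym: "lly_curvature V E w x y = lly_curvature V E w y x"
  by (simp add: lly_curvature_def ollivier_curvature_sym[of V _ E w x y])

(* In the following, \<open>K\<close> is a notion of curvature on an edge xy, given the edge set and the
   weights: \<open>ollivier_curvature V \<alpha>\<close> or \<open>lly_curvature V\<close>. *)

definition flow_step ::
  "('a set set \<Rightarrow> ('a set \<Rightarrow> real) \<Rightarrow> 'a \<Rightarrow> 'a \<Rightarrow> real) \<Rightarrow> real \<Rightarrow>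
   'a set set \<Rightarrow> ('a set \<Rightarrow> real) \<Rightarrow> 'a set \<Rightarrow> real" where
  "flow_step K s E w =
     (\<lambda>e\<in>E. on_edge (path_dist E w) e - s * on_edge (K E w) e * on_edge (path_dist E w) e)"

(* Weight vectors are made extensional on E, so that uniqueness of a solution is equality of
   functions. *)
definition ricci_flow_solution ::
  "('a set set \<Rightarrow> ('a set \<Rightarrow> real) \<Rightarrow> 'a \<Rightarrow> 'a \<Rightarrow> real) \<Rightarrow> real \<Rightarrow>
   'a set set \<Rightarrow> ('a set \<Rightarrow> real) \<Rightarrow> (nat \<Rightarrow> 'a set \<Rightarrow> real) \<Rightarrow> bool" where
  "ricci_flow_solution K s E w0 w \<longleftrightarrow>
     (\<forall>j. w j \<in> E \<rightarrow>\<^sub>E {0<..}) \<and>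
     (\<forall>e\<in>E. w 0 e = w0 e) \<and>
     (\<forall>j. \<forall>e\<in>E. w (Suc j) e = flow_step K s E (w j) e)"

definition surgery :: "real \<Rightarrow> 'a set set \<Rightarrow> ('a set \<Rightarrow> real) \<Rightarrow> 'a set set" where
  "surgery \<theta> E w = E - {e \<in> E. w e / on_edge (path_dist E w) e > \<theta>}"

(* The pair at j consists of the edge set before the surgery of iteration j, i.e. the edges
   remaining at iteration j - 1, and of the weights at iteration j. *)
primrec surgery_state ::
  "('a set set \<Rightarrow> ('a set \<Rightarrow> real) \<Rightarrow> 'a \<Rightarrow> 'a \<Rightarrow> real) \<Rightarrow> real \<Rightarrow> real \<Rightarrow>
   'a set set \<Rightarrow> ('a set \<Rightarrow> real) \<Rightarrow> nat \<Rightarrow> 'a set set \<times> ('a set \<Rightarrow> real)" where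
  "surgery_state K s \<theta> E w0 0 = (E, w0)"
| "surgery_state K s \<theta> E w0 (Suc j) =
     (let (F, w) = surgery_state K s \<theta> E w0 j; F' = surgery \<theta> F w
      in (F', flow_step K s F' w))"

definition surgery_weights ::
  "('a set set \<Rightarrow> ('a set \<Rightarrow> real) \<Rightarrow> 'a \<Rightarrow> 'a \<Rightarrow> real) \<Rightarrow> real \<Rightarrow> real \<Rightarrow>
   'a set set \<Rightarrow> ('a set \<Rightarrow> real) \<Rightarrow> nat \<Rightarrow> 'a set \<Rightarrow> real" where
  "surgery_weights K s \<theta> E w0 j = snd (surgery_state K s \<theta> E w0 j)"

definition remaining_edges ::
  "('a set set \<Rightarrow> ('a set \<Rightarrow> real) \<Rightarrow> 'a \<Rightarrow> 'a \<Rightarrow> real) \<Rightarrow> real \<Rightarrow> real \<Rightarrow>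
   'a set set \<Rightarrow> ('a set \<Rightarrow> real) \<Rightarrow> nat \<Rightarrow> 'a set set" where
  "remaining_edges K s \<theta> E w0 j = fst (surgery_state K s \<theta> E w0 (Suc j))"

end

theory Submission imports Defs begin

text \<open>
  The proof only uses that the curvature satisfies
  \<open>\<rho> - (\<Sum>\<tau>\<in>E. w \<tau>) \<le> \<kappa> \<rho> \<le> c \<rho>\<close>, with \<open>c = 1\<close> for Ollivier's curvature and \<open>c = 2\<close> for Lin-Lu-Yau's.
  One step of the flow then yields a weight between \<open>(1 - c s) \<rho>\<close> and \<open>\<rho> + s (\<Sum>\<tau>\<in>E. w \<tau>)\<close>. On
  edges that survive the surgery \<open>\<rho> \<ge> w / \<theta>\<close>, which gives the lower bound, and summing
  the upper bound over all edges gives the exponential bound for the total weight.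

  For Ollivier's curvature the two inequalities say \<open>0 \<le> W \<le> (\<Sum>\<tau>\<in>E. w \<tau>)\<close>. For Lin-Lu-Yau's,
  \<open>(\<rho> - W\<^sub>\<alpha>) / (1 - \<alpha>)\<close> is nondecreasing in \<open>\<alpha>\<close>, since mixing a coupling with the point mass
  at \<open>(x, y)\<close> makes both walks lazier; and it is at most \<open>2 \<rho>\<close>, since every coupling puts mass at
  least \<open>2 \<alpha> - 1\<close> on \<open>(x, y)\<close>. Hence the limit exists and lies between the value at \<open>\<alpha> = 0\<close> and \<open>2 \<rho>\<close>.
\<close>

section \<open>Paths and distances\<close>

lemma path_edges_subset: "e \<in> set (path_edges p) \<Longrightarrow> e \<subseteq> set p"
proof (induction p rule: induct_list012)
  case (3 a b p)
  then show ?case by (auto simp: path_edges_Cons)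
qed (simp_all add: path_edges_def)

text \<open>The edges after the first avoid the head of the path. Hence the length of a path is the
  sum over a set of edges and can be compared with the total weight.\<close>

lemma distinct_path_edges: "distinct p \<Longrightarrow> distinct (path_edges p)"
proof (induction p rule: induct_list012)
  case (3 a b p)
  have "{a, b} \<notin> set (path_edges (b # p))"
    using 3 path_edges_subset[of "{a, b}" "b # p"] by auto
  then show ?case using 3 by (simp add: path_edges_Cons)
qed (simp_all add: path_edges_def)

lemma path_edges_append: "set (path_edges p) \<subseteq> set (path_edges (p @ q))"
proof (induction p rule: induct_list012)
  case (3 a b p)
  then show ?case by (auto simp: path_edges_Cons)
qed (simp_all add: path_edges_def)

text \<open>Vertices of a path are distinct, so concatenated paths need not be paths; this relation
  is transitive by construction and is converted back by \<open>joined_imp_is_path\<close>.\<close>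

definition joined :: "'a set set \<Rightarrow> 'a \<Rightarrow> 'a \<Rightarrow> bool" where
  "joined E = (\<lambda>x y. {x, y} \<in> E)\<^sup>*\<^sup>*"

lemma is_path_refl: "is_path E x [x] x"
  by (simp add: is_path_def path_edges_def)

lemma is_path_edge: "{x, y} \<in> E \<Longrightarrow> x \<noteq> y \<Longrightarrow> is_path E x [x, y] y"
  by (simp add: is_path_def path_edges_def)

text \<open>If the new vertex already lies on the path, the path is cut off there.\<close>

lemma is_path_extend:
  assumes "is_path E x p y" "{y, z} \<in> E"
  shows "\<exists>q. is_path E x q z"
proof (cases "z \<in> set p")
  case True
  then obtain q r where p: "p = (q @ [z]) @ r"
    by (metis append.assoc append_Cons append_Nil split_list)
  have "set (path_edges (q @ [z])) \<subseteq> set (path_edges p)"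
    unfolding p by (rule path_edges_append)
  moreover have "hd (q @ [z]) = hd p"
    unfolding p by (cases q) simp_all
  ultimately have "is_path E x (q @ [z]) z"
    using assms(1) by (auto simp: is_path_def p)
  then show ?thesis ..
next
  case False
  then have "is_path E x (p @ [z]) z"
    using assms by (auto simp: is_path_def path_edges_snoc)
  then show ?thesis ..
qed

lemma joined_imp_is_path: "joined E x y \<Longrightarrow> \<exists>p. is_path E x p y"
  unfolding joined_def
  by (induction rule: rtranclp_induct) (blast intro: is_path_refl is_path_extend)+

text \<open>Each edge of the path may be replaced by a detour in another edge set \<open>F\<close>;
  this reroutes a path of the graph before surgery through the surviving edges.\<close>

lemma joined_path_edges:
  assumes "p \<noteq> []" "\<And>u v. {u, v} \<in> set (path_edges p) \<Longrightarrow> joined F u v"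
  shows "joined F (hd p) (last p)"
  using assms
proof (induction p rule: induct_list012)
  case (3 a b p)
  have "joined F b (last (b # p))"
    using 3 by (auto simp: path_edges_Cons)
  moreover have "joined F a b"
    using 3 by (auto simp: path_edges_Cons)
  ultimately show ?case by (simp add: joined_def)
qed (auto simp: joined_def)

text \<open>This is the invariant of the flow. Positivity is demanded on \<open>E\<close> only, so
  that one weight function serves before and after surgery.\<close>

locale weighted_graph =
  fixes V :: "'a set" and E :: "'a set set" and w :: "'a set \<Rightarrow> real"
  assumes graph: "finite_connected_graph V E"
    and weight_pos: "e \<in> E \<Longrightarrow> 0 < w e"
begin

lemma finite_V: "finite V"
  using graph by (simp add: finite_connected_graph_def)

lemma finite_E: "finite E"
  by (rule finite_subset[of _ "Pow V"]) (use graph in \<open>auto simp: finite_connected_graph_def\<close>)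

lemma edge_vertices:
  assumes "{x, y} \<in> E"
  shows "x \<in> V" "y \<in> V" "x \<noteq> y"
proof -
  have "{x, y} \<subseteq> V" "card {x, y} = 2"
    using graph assms unfolding finite_connected_graph_def by blast+
  then show "x \<in> V" "y \<in> V" "x \<noteq> y" by auto
qed

lemma edge_doubleton:
  assumes "e \<in> E"
  obtains x y where "e = {x, y}"
  using graph assms unfolding finite_connected_graph_def by (metis card_2_iff)

lemma path_exists: "x \<in> V \<Longrightarrow> y \<in> V \<Longrightarrow> \<exists>p. is_path E x p y"
  using graph by (simp add: finite_connected_graph_def)

lemma path_length_eq_sum:
  assumes "is_path E x p y"
  shows "path_length w p = sum w (set (path_edges p))"
  using assms by (simp add: path_length_def is_path_def distinct_path_edges sum_list_distinct_conv_sum_set)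

lemma path_length_nonneg: "is_path E x p y \<Longrightarrow> 0 \<le> path_length w p"
  by (force simp: path_length_eq_sum is_path_def intro: sum_nonneg less_imp_le[OF weight_pos])

lemma path_length_le_sum: "is_path E x p y \<Longrightarrow> path_length w p \<le> sum w E"
  by (force simp: path_length_eq_sum is_path_def
      intro: sum_mono2 finite_E less_imp_le[OF weight_pos])

lemma weight_le_path_length:
  assumes "is_path E x p y" "e \<in> set (path_edges p)"
  shows "w e \<le> path_length w p"
  unfolding path_length_eq_sum[OF assms(1)]
  by (rule member_le_sum) (use assms in \<open>auto simp: is_path_def intro: less_imp_le[OF weight_pos]\<close>)

lemma path_dist_le_length:
  assumes "is_path E x p y"
  shows "path_dist E w x y \<le> path_length w p"
  unfolding path_dist_def
  by (rule cINF_lower) (use assms in \<open>auto intro!: bdd_belowI2[of _ 0] path_length_nonneg\<close>)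

lemma path_dist_greatest:
  assumes "x \<in> V" "y \<in> V" "\<And>p. is_path E x p y \<Longrightarrow> c \<le> path_length w p"
  shows "c \<le> path_dist E w x y"
  unfolding path_dist_def by (rule cINF_greatest) (use assms path_exists in auto)

lemma path_dist_nonneg: "x \<in> V \<Longrightarrow> y \<in> V \<Longrightarrow> 0 \<le> path_dist E w x y"
  by (blast intro: path_dist_greatest path_length_nonneg)

lemma path_dist_le_sum: "x \<in> V \<Longrightarrow> y \<in> V \<Longrightarrow> path_dist E w x y \<le> sum w E"
  using path_exists path_dist_le_length path_length_le_sum order_trans by metis

lemma path_dist_le_weight: "{x, y} \<in> E \<Longrightarrow> path_dist E w x y \<le> w {x, y}"
  using path_dist_le_length[OF is_path_edge, of x y] edge_vertices[of x y]
  by (simp add: path_length_def path_edges_def)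

text \<open>A path between distinct vertices has an edge, so the smallest edge weight bounds all
  path lengths. The bound is uniform and thus survives the infimum.\<close>

lemma path_dist_pos:
  assumes "x \<in> V" "y \<in> V" "x \<noteq> y"
  shows "0 < path_dist E w x y"
proof -
  have edge: "\<exists>e\<in>E. w e \<le> path_length w p" if p: "is_path E x p y" for p
  proof -
    obtain b q where "p = x # b # q"
      using p assms(3) by (cases p; cases "tl p") (auto simp: is_path_def)
    then have "{x, b} \<in> set (path_edges p)" by (simp add: path_edges_Cons)
    then show ?thesis using p weight_le_path_length by (auto simp: is_path_def)
  qed
  then have "E \<noteq> {}" using path_exists assms by blast
  then have "0 < Min (w ` E)" using finite_E weight_pos by simp
  also have "Min (w ` E) \<le> path_dist E w x y"
  proof (rule path_dist_greatest[OF assms(1,2)])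
    fix p assume "is_path E x p y"
    then obtain e where "e \<in> E" "w e \<le> path_length w p" using edge by blast
    then show "Min (w ` E) \<le> path_length w p"
      by (meson Min_le finite_E finite_imageI imageI order_trans)
  qed
  finally show ?thesis .
qed

lemma short_path_exists:
  assumes "x \<in> V" "y \<in> V" "path_dist E w x y < c"
  shows "\<exists>p. is_path E x p y \<and> path_length w p < c"
  using path_dist_greatest[OF assms(1,2), of c] assms(3) by force

section \<open>Effect of surgery on connectedness and distances\<close>

lemma surgery_subset: "surgery \<theta> E w \<subseteq> E"
  by (auto simp: surgery_def)

lemma on_edge_dist: "on_edge (path_dist E w) {x, y} = path_dist E w x y"
  by (simp add: on_edge_doubleton path_dist_sym)

text \<open>
  By induction on the weight: the endpoints of a removed edge are joined by a path shorter than
  the weight of that edge, so all edges of this path are lighter.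
\<close>

lemma finite_connected_graph_surgery:
  assumes "1 \<le> \<theta>"
  shows "finite_connected_graph V (surgery \<theta> E w)"
proof -
  define F where "F = surgery \<theta> E w"
  have edge_joined: "e \<in> E \<Longrightarrow> e = {x, y} \<Longrightarrow> joined F x y" for e x y
  \<comment> \<open>The number of strictly lighter edges stands in for the weight, since the order
    of the reals is not well-founded.\<close>
  proof (induction "card {f \<in> E. w f < w e}" arbitrary: e x y rule: less_induct)
    case less
    show ?case
    proof (cases "e \<in> F")
      case True
      then show ?thesis using less.prems by (auto simp: joined_def)
    next
      case False
      then have "\<theta> < w e / path_dist E w x y"
        using less.prems by (auto simp: F_def surgery_def on_edge_dist)
      moreover have V: "x \<in> V" "y \<in> V" "x \<noteq> y"
        using edge_vertices less.prems by blast+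
      moreover note path_dist_pos[OF this]
      ultimately have "\<theta> * path_dist E w x y < w e"
        by (simp add: pos_less_divide_eq)
      moreover have "1 * path_dist E w x y \<le> \<theta> * path_dist E w x y"
        using assms path_dist_nonneg V by (intro mult_right_mono) auto
      ultimately obtain p where p: "is_path E x p y" "path_length w p < w e"
        using short_path_exists[OF V(1,2), of "w e"] by auto
      have "joined F u v" if uv: "{u, v} \<in> set (path_edges p)" for u v
      proof -
        have "w {u, v} < w e" using weight_le_path_length[OF p(1) uv] p(2) by simp
        moreover have uvE: "{u, v} \<in> E" using p(1) uv by (auto simp: is_path_def)
        ultimately have "{f \<in> E. w f < w {u, v}} \<subset> {f \<in> E. w f < w e}"
          by auto
        then show ?thesis
          using less.hyps[OF psubset_card_mono uvE refl] finite_E by auto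
      qed
      then show ?thesis using joined_path_edges[of p F] p(1) by (auto simp: is_path_def)
    qed
  qed
  have "\<exists>p. is_path F x p y" if xy: "x \<in> V" "y \<in> V" for x y
  proof -
    obtain p where p: "is_path E x p y" using path_exists[OF xy] by blast
    then have "joined F x y"
      using joined_path_edges[of p F] edge_joined by (auto simp: is_path_def)
    then show ?thesis by (rule joined_imp_is_path)
  qed
  then show ?thesis
    using graph surgery_subset[of \<theta>] unfolding finite_connected_graph_def F_def by blast
qed

text \<open>Surviving the surgery bounds the weight by the old distance, and the new distance is no
  smaller because fewer edges leave fewer paths.\<close>

lemma weight_le_surgery_dist:
  assumes "1 \<le> \<theta>" "{x, y} \<in> surgery \<theta> E w"
  shows "w {x, y} \<le> \<theta> * path_dist (surgery \<theta> E w) w x y"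
proof -
  let ?F = "surgery \<theta> E w"
  interpret F: weighted_graph V ?F w
    using finite_connected_graph_surgery[OF assms(1)] surgery_subset[of \<theta>] weight_pos
    by unfold_locales auto
  have V: "x \<in> V" "y \<in> V" "x \<noteq> y" using F.edge_vertices[OF assms(2)] by auto
  have "path_dist E w x y \<le> path_dist ?F w x y"
  proof (rule F.path_dist_greatest[OF V(1,2)])
    fix p assume "is_path ?F x p y"
    then show "path_dist E w x y \<le> path_length w p"
      using surgery_subset[of \<theta>] by (intro path_dist_le_length) (auto simp: is_path_def)
  qed
  moreover have "w {x, y} \<le> \<theta> * path_dist E w x y"
    using assms(2) path_dist_pos[OF V] by (auto simp: surgery_def on_edge_dist field_simps)
  ultimately show ?thesis
    using assms(1) mult_left_mono[of "path_dist E w x y" "path_dist ?F w x y" \<theta>] by linarith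
qed

end

section \<open>Couplings and the Wasserstein distance\<close>

locale bounded_distance =
  fixes V :: "'a set" and d :: "'a \<Rightarrow> 'a \<Rightarrow> real" and D :: real
  assumes finite_V: "finite V"
    and dist_nonneg: "u \<in> V \<Longrightarrow> v \<in> V \<Longrightarrow> 0 \<le> d u v"
    and dist_le: "u \<in> V \<Longrightarrow> v \<in> V \<Longrightarrow> d u v \<le> D"
begin

definition prob :: "('a \<Rightarrow> real) \<Rightarrow> bool" where
  "prob \<mu> \<longleftrightarrow> (\<forall>u\<in>V. 0 \<le> \<mu> u) \<and> sum \<mu> V = 1"

definition cost :: "('a \<Rightarrow> 'a \<Rightarrow> real) \<Rightarrow> real" where
  "cost A = (\<Sum>u\<in>V. \<Sum>v\<in>V. A u v * d u v)"

lemma prob_le_1: "prob \<mu> \<Longrightarrow> u \<in> V \<Longrightarrow> \<mu> u \<le> 1"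
  using member_le_sum[of u V \<mu>] finite_V by (auto simp: prob_def)

text \<open>The independent coupling shows that the infimum in \<open>wasserstein\<close> ranges
  over a nonempty set, so that lower bounds on all costs pass to it.\<close>

lemma coupling_product:
  assumes "prob \<mu>" "prob \<nu>"
  shows "coupling V \<mu> \<nu> (\<lambda>u v. \<mu> u * \<nu> v)"
  using assms prob_le_1
  by (auto simp: coupling_def prob_def sum_distrib_left[symmetric] sum_distrib_right[symmetric]
      intro!: mult_nonneg_nonneg mult_le_one)

lemma cost_nonneg: "coupling V \<mu> \<nu> A \<Longrightarrow> 0 \<le> cost A"
  by (auto simp: cost_def coupling_def intro!: sum_nonneg mult_nonneg_nonneg dist_nonneg)

text \<open>A coupling has total mass 1, so its cost is an average of distances.\<close>

lemma cost_le:
  assumes "prob \<mu>" "coupling V \<mu> \<nu> A"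
  shows "cost A \<le> D"
proof -
  have "cost A \<le> (\<Sum>u\<in>V. \<Sum>v\<in>V. A u v * D)"
    unfolding cost_def using assms
    by (intro sum_mono mult_left_mono dist_le) (auto simp: coupling_def)
  also have "\<dots> = D"
    using assms by (simp add: coupling_def prob_def sum_distrib_right[symmetric])
  finally show ?thesis .
qed

lemma wasserstein_le_cost:
  assumes "coupling V \<mu> \<nu> A"
  shows "wasserstein V d \<mu> \<nu> \<le> cost A"
  unfolding wasserstein_def cost_def
  by (rule cINF_lower)
    (use assms cost_nonneg in \<open>auto simp: cost_def intro!: bdd_belowI2[of _ 0]\<close>)

lemma wasserstein_greatest:
  assumes "prob \<mu>" "prob \<nu>" "\<And>A. coupling V \<mu> \<nu> A \<Longrightarrow> c \<le> cost A"
  shows "c \<le> wasserstein V d \<mu> \<nu>"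
  unfolding wasserstein_def
  by (rule cINF_greatest) (use assms coupling_product in \<open>auto simp: cost_def\<close>)

lemma wasserstein_nonneg: "prob \<mu> \<Longrightarrow> prob \<nu> \<Longrightarrow> 0 \<le> wasserstein V d \<mu> \<nu>"
  by (blast intro: wasserstein_greatest cost_nonneg)

lemma wasserstein_le: "prob \<mu> \<Longrightarrow> prob \<nu> \<Longrightarrow> wasserstein V d \<mu> \<nu> \<le> D"
  by (meson order_trans wasserstein_le_cost cost_le coupling_product)

text \<open>Of the mass \<open>\<mu> x\<close>, the part not sent to \<open>y\<close> must fit under
  \<open>\<nu>\<close> outside \<open>y\<close>, hence is at most \<open>1 - \<nu> y\<close>. The
  rest travels from \<open>x\<close> to \<open>y\<close>.\<close>

lemma wasserstein_ge_point:
  assumes "prob \<mu>" "prob \<nu>" "x \<in> V" "y \<in> V"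
  shows "(\<mu> x + \<nu> y - 1) * d x y \<le> wasserstein V d \<mu> \<nu>"
proof (rule wasserstein_greatest[OF assms(1,2)])
  fix A assume A: "coupling V \<mu> \<nu> A"
  have nonneg: "0 \<le> A u v" if "u \<in> V" "v \<in> V" for u v
    using A that by (auto simp: coupling_def)
  have "\<mu> x = A x y + (\<Sum>v\<in>V - {y}. A x v)"
    using A assms finite_V by (simp add: coupling_def sum.remove[symmetric])
  also have "(\<Sum>v\<in>V - {y}. A x v) \<le> (\<Sum>v\<in>V - {y}. \<nu> v)"
  proof (rule sum_mono)
    fix v assume v: "v \<in> V - {y}"
    have "A x v \<le> (\<Sum>u\<in>V. A u v)"
      by (rule member_le_sum) (use v assms finite_V nonneg in auto)
    then show "A x v \<le> \<nu> v" using A v by (auto simp: coupling_def)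
  qed
  also have "(\<Sum>v\<in>V - {y}. \<nu> v) = 1 - \<nu> y"
    using assms finite_V by (simp add: sum_diff1 prob_def)
  finally have "(\<mu> x + \<nu> y - 1) * d x y \<le> A x y * d x y"
    using assms dist_nonneg by (intro mult_right_mono) auto
  also have "\<dots> \<le> (\<Sum>v\<in>V. A x v * d x v)"
    by (rule member_le_sum) (use assms finite_V nonneg dist_nonneg in auto)
  also have "\<dots> \<le> cost A"
    unfolding cost_def
    by (rule member_le_sum[where f = "\<lambda>u. \<Sum>v\<in>V. A u v * d u v"])
      (use assms finite_V nonneg dist_nonneg in \<open>auto intro!: sum_nonneg\<close>)
  finally show "(\<mu> x + \<nu> y - 1) * d x y \<le> cost A" .
qed

lemma wasserstein_mix_point:
  assumes "prob \<mu>" "prob \<nu>" "x \<in> V" "y \<in> V" "0 < t" "t \<le> 1"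
    and \<mu>': "\<And>u. u \<in> V \<Longrightarrow> \<mu>' u = t * \<mu> u + (1 - t) * of_bool (u = x)"
    and \<nu>': "\<And>u. u \<in> V \<Longrightarrow> \<nu>' u = t * \<nu> u + (1 - t) * of_bool (u = y)"
  shows "wasserstein V d \<mu>' \<nu>' \<le> t * wasserstein V d \<mu> \<nu> + (1 - t) * d x y"
proof -
  have mix: "wasserstein V d \<mu>' \<nu>' \<le> t * cost A + (1 - t) * d x y" if A: "coupling V \<mu> \<nu> A" for A
  proof -
    define B where "B u v = t * A u v + (1 - t) * (of_bool (u = x) * of_bool (v = y))" for u v
    \<comment> \<open>These are sums against the point mass at \<open>(x, y)\<close>. The free
      factor \<open>c\<close> is a constant or an indicator for the marginals and a distance for the
      cost.\<close>
    have row: "(\<Sum>v\<in>V. of_bool (u = x) * of_bool (v = y) * c v) = of_bool (u = x) * c y"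
      for u and c :: "'a \<Rightarrow> real"
      using assms(4) finite_V by (auto simp: of_bool_def if_distrib[of "\<lambda>z. z * _"] cong: if_cong)
    have col: "(\<Sum>u\<in>V. of_bool (u = x) * c u) = c x" for c :: "'a \<Rightarrow> real"
      using assms(3) finite_V by (auto simp: of_bool_def if_distrib[of "\<lambda>z. z * _"] cong: if_cong)
    have "coupling V \<mu>' \<nu>' B"
      unfolding coupling_def
    proof (intro conjI ballI)
      fix u v assume "u \<in> V" "v \<in> V"
      then have uv: "0 \<le> A u v" "A u v \<le> 1" using A by (auto simp: coupling_def)
      have "B u v \<le> t * 1 + (1 - t) * 1"
        unfolding B_def using uv assms(5,6) by (intro add_mono mult_left_mono) auto
      moreover have "0 \<le> B u v"
        unfolding B_def using uv assms(5,6) by (intro add_nonneg_nonneg mult_nonneg_nonneg) auto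
      ultimately show "B u v \<in> {0..1}" by simp
    next
      fix u assume "u \<in> V"
      then show "(\<Sum>v\<in>V. B u v) = \<mu>' u"
        using A row[of u "\<lambda>_. 1"]
        by (simp add: B_def sum.distrib sum_distrib_left[symmetric] coupling_def \<mu>')
    next
      fix v assume "v \<in> V"
      then show "(\<Sum>u\<in>V. B u v) = \<nu>' v"
        using A col[of "\<lambda>_. of_bool (v = y)"]
        by (simp add: B_def sum.distrib sum_distrib_left[symmetric] coupling_def \<nu>')
    qed
    moreover have "cost B = t * cost A + (1 - t) * d x y"
    proof -
      have "cost B = (\<Sum>u\<in>V. \<Sum>v\<in>V. t * (A u v * d u v)
          + (1 - t) * (of_bool (u = x) * of_bool (v = y) * d u v))"
        unfolding cost_def B_def by (intro sum.cong refl) (simp add: algebra_simps)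
      also have "\<dots> = t * cost A + (1 - t) * d x y"
        by (simp only: sum.distrib sum_distrib_left[symmetric] row col cost_def)
      finally show ?thesis .
    qed
    ultimately show ?thesis using wasserstein_le_cost by metis
  qed
  \<comment> \<open>Solved for the cost, the estimate is a lower bound valid for every coupling, so
    it passes to the infimum.\<close>
  have "(wasserstein V d \<mu>' \<nu>' - (1 - t) * d x y) / t \<le> wasserstein V d \<mu> \<nu>"
    by (rule wasserstein_greatest[OF assms(1,2)])
      (use mix assms(5) in \<open>auto simp: divide_le_eq algebra_simps\<close>)
  then show ?thesis using assms(5) by (simp add: divide_le_eq algebra_simps)
qed

end

section \<open>Curvature bounds\<close>

text \<open>The left limit is the supremum over the interval. Convergence must be established
  because \<open>Lim\<close> says nothing about a function without a limit.\<close>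

lemma mono_bounded_tendsto_at_left:
  fixes f :: "real \<Rightarrow> real"
  assumes "a < b" and mono: "mono_on {a..<b} f" and bound: "\<And>x. x \<in> {a..<b} \<Longrightarrow> f x \<le> c"
  obtains l where "(f \<longlongrightarrow> l) (at_left b)" "f a \<le> l" "l \<le> c"
proof
  let ?l = "Sup (f ` {a..<b})"
  have bdd: "bdd_above (f ` {a..<b})" using bound by (rule bdd_aboveI2)
  have upper: "f x \<le> ?l" if "x \<in> {a..<b}" for x
    using that bdd by (auto intro: cSup_upper)
  show "(f \<longlongrightarrow> ?l) (at_left b)"
  proof (rule order_tendstoI)
    fix y assume "y < ?l"
    then obtain x where x: "x \<in> {a..<b}" "y < f x"
      using less_cSup_iff[OF _ bdd, of y] \<open>a < b\<close> by auto
    have "eventually (\<lambda>z. z \<in> {x<..<b}) (at_left b)"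
      using x by (intro eventually_at_leftI[of x]) auto
    then show "eventually (\<lambda>z. y < f z) (at_left b)"
    proof eventually_elim
      case (elim z)
      then have "f x \<le> f z" using mono x by (auto intro: mono_onD)
      then show ?case using x by simp
    qed
  next
    fix y assume y: "?l < y"
    have "eventually (\<lambda>z. z \<in> {a<..<b}) (at_left b)"
      using \<open>a < b\<close> by (intro eventually_at_leftI[of a]) auto
    then show "eventually (\<lambda>z. f z < y) (at_left b)"
    proof eventually_elim
      case (elim z)
      then show ?case using upper[of z] y by auto
    qed
  qed
  show "f a \<le> ?l" using upper \<open>a < b\<close> by simp
  show "?l \<le> c" using \<open>a < b\<close> bound by (intro cSup_least) auto
qed

section \<open>Lazy walks and the two curvatures\<close>

context weighted_graph
begin

sublocale bounded_distance V "path_dist E w" "sum w E"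
  by unfold_locales (simp_all add: finite_V path_dist_nonneg path_dist_le_sum)

text \<open>The edge to \<open>y\<close> gives \<open>x\<close> a neighbour, so the normalising sum
  is positive. As there are no loops, the mass \<alpha> at \<open>x\<close> is separate from the
  mass on the neighbours.\<close>

lemma prob_lazy_walk:
  assumes "{x, y} \<in> E" "0 \<le> \<alpha>" "\<alpha> \<le> 1"
  shows "prob (lazy_walk E w \<alpha> x)"
proof -
  let ?N = "{u. {x, u} \<in> E}"
  have N: "?N \<subseteq> V - {x}" using edge_vertices by blast
  then have fin: "finite ?N" using finite_V finite_subset by blast
  have pos: "0 < (\<Sum>u\<in>?N. w {x, u})"
    using fin assms(1) weight_pos by (intro sum_pos) auto
  have "sum (lazy_walk E w \<alpha> x) V = \<alpha> + sum (lazy_walk E w \<alpha> x) (V - {x})"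
    using finite_V edge_vertices[OF assms(1)] by (subst sum.remove[of V x]) (auto simp: lazy_walk_def)
  also have "sum (lazy_walk E w \<alpha> x) (V - {x}) = sum (lazy_walk E w \<alpha> x) ?N"
    using N finite_V by (intro sum.mono_neutral_right) (auto simp: lazy_walk_def)
  also have "\<dots> = (\<Sum>z\<in>?N. (1 - \<alpha>) / (\<Sum>u\<in>?N. w {x, u}) * w {x, z})"
    using N by (intro sum.cong) (auto simp: lazy_walk_def)
  also have "\<dots> = (1 - \<alpha>) / (\<Sum>u\<in>?N. w {x, u}) * (\<Sum>u\<in>?N. w {x, u})"
    by (simp only: sum_distrib_left)
  also have "\<dots> = 1 - \<alpha>"
    using pos by simp
  finally have "sum (lazy_walk E w \<alpha> x) V = 1" by simp
  moreover have "0 \<le> lazy_walk E w \<alpha> x u" for u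
    using assms(2,3) pos weight_pos[of "{x, u}"] by (auto simp: lazy_walk_def)
  ultimately show ?thesis by (simp add: prob_def)
qed

text \<open>The factor \<open>t\<close> rescales the moving mass \<open>1 - \<alpha>\<close> to
  \<open>1 - \<beta>\<close>; the mass at \<open>x\<close> then agrees because
  \<open>t * \<alpha> + (1 - t) = \<beta>\<close>.\<close>

lemma lazy_walk_mix:
  assumes "\<alpha> < 1" "t = (1 - \<beta>) / (1 - \<alpha>)"
  shows "lazy_walk E w \<beta> x u = t * lazy_walk E w \<alpha> x u + (1 - t) * of_bool (u = x)"
proof -
  have t: "t * (1 - \<alpha>) = 1 - \<beta>" using assms by simp
  then have "\<beta> = t * \<alpha> + (1 - t)" by (simp add: algebra_simps)
  then show ?thesis
    using t by (simp add: lazy_walk_def mult.assoc[symmetric])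
qed

abbreviation walk_dist :: "'a \<Rightarrow> 'a \<Rightarrow> real \<Rightarrow> real" where
  "walk_dist x y \<alpha> \<equiv> wasserstein V (path_dist E w) (lazy_walk E w \<alpha> x) (lazy_walk E w \<alpha> y)"

lemma walk_dist_bounds:
  assumes "{x, y} \<in> E" "0 \<le> \<alpha>" "\<alpha> \<le> 1"
  shows "0 \<le> walk_dist x y \<alpha>" "walk_dist x y \<alpha> \<le> sum w E"
    and "(2 * \<alpha> - 1) * path_dist E w x y \<le> walk_dist x y \<alpha>"
proof -
  have yx: "{y, x} \<in> E" using assms(1) by (simp add: insert_commute)
  note P = prob_lazy_walk[OF assms] prob_lazy_walk[OF yx assms(2,3)]
  show "0 \<le> walk_dist x y \<alpha>" "walk_dist x y \<alpha> \<le> sum w E"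
    by (rule wasserstein_nonneg[OF P], rule wasserstein_le[OF P])
  show "(2 * \<alpha> - 1) * path_dist E w x y \<le> walk_dist x y \<alpha>"
    using wasserstein_ge_point[OF P edge_vertices(1,2)[OF assms(1)]] by (simp add: lazy_walk_def)
qed

text \<open>The flow contains the curvature only multiplied by the distance, and this product is
  free of division.\<close>

lemma ollivier_curvature_times_dist:
  assumes "{x, y} \<in> E"
  shows "ollivier_curvature V \<alpha> E w x y * path_dist E w x y = path_dist E w x y - walk_dist x y \<alpha>"
  using path_dist_pos[OF edge_vertices[OF assms]] by (simp add: ollivier_curvature_def field_simps)

text \<open>Mixing with point masses at \<open>x\<close> and \<open>y\<close> turns the walks at
  \<alpha> into those at \<beta> and multiplies the numerator by at least \<open>t\<close>, which is
  exactly the ratio of the denominators.\<close>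

lemma scaled_ollivier_curvature_mono:
  assumes xy: "{x, y} \<in> E"
  shows "mono_on {0..<1} (\<lambda>\<alpha>. (path_dist E w x y - walk_dist x y \<alpha>) / (1 - \<alpha>))"
proof (rule mono_onI)
  fix \<alpha> \<beta> :: real assume \<alpha>\<beta>: "\<alpha> \<in> {0..<1}" "\<beta> \<in> {0..<1}" "\<alpha> \<le> \<beta>"
  have yx: "{y, x} \<in> E" using xy by (simp add: insert_commute)
  define t where "t = (1 - \<beta>) / (1 - \<alpha>)"
  let ?d = "path_dist E w x y"
  have t: "0 < t" "t \<le> 1" using \<alpha>\<beta> by (auto simp: t_def)
  have "walk_dist x y \<beta> \<le> t * walk_dist x y \<alpha> + (1 - t) * ?d"
    using \<alpha>\<beta> t_def
    by (intro wasserstein_mix_point[OF _ _ edge_vertices(1,2)[OF xy] t] lazy_walk_mix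
        prob_lazy_walk[OF xy] prob_lazy_walk[OF yx]) auto
  then have "t * (?d - walk_dist x y \<alpha>) \<le> ?d - walk_dist x y \<beta>"
    by (simp add: algebra_simps)
  then show "(?d - walk_dist x y \<alpha>) / (1 - \<alpha>) \<le> (?d - walk_dist x y \<beta>) / (1 - \<beta>)"
    using \<alpha>\<beta> by (simp add: t_def field_simps)
qed

lemma lly_curvature_bounds:
  assumes xy: "{x, y} \<in> E"
  shows "path_dist E w x y - sum w E \<le> lly_curvature V E w x y * path_dist E w x y"
    and "lly_curvature V E w x y * path_dist E w x y \<le> 2 * path_dist E w x y"
proof -
  let ?d = "path_dist E w x y"
  have d: "0 < ?d" using path_dist_pos[OF edge_vertices[OF xy]] .
  let ?g = "\<lambda>\<alpha>. (?d - walk_dist x y \<alpha>) / (1 - \<alpha>)"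
  \<comment> \<open>The factor 2 arises from
    \<open>1 - (2 * \<alpha> - 1) = 2 * (1 - \<alpha>)\<close>, which cancels the
    denominator.\<close>
  have bound: "?g \<alpha> \<le> 2 * ?d" if "\<alpha> \<in> {0..<1}" for \<alpha>
    using walk_dist_bounds(3)[OF xy, of \<alpha>] that by (simp add: pos_divide_le_eq algebra_simps)
  obtain l where l: "(?g \<longlongrightarrow> l) (at_left 1)" "?g 0 \<le> l" "l \<le> 2 * ?d"
    using mono_bounded_tendsto_at_left[OF zero_less_one scaled_ollivier_curvature_mono[OF xy] bound]
    by blast
  have "ollivier_curvature V \<alpha> E w x y = (?d - walk_dist x y \<alpha>) / ?d" for \<alpha>
    using ollivier_curvature_times_dist[OF xy, of \<alpha>] d by (simp add: eq_divide_eq)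
  then have "(\<lambda>\<alpha>. ollivier_curvature V \<alpha> E w x y / (1 - \<alpha>)) = (\<lambda>\<alpha>. ?g \<alpha> / ?d)"
    by (simp add: mult.commute)
  moreover have "((\<lambda>\<alpha>. ?g \<alpha> / ?d) \<longlongrightarrow> l / ?d) (at_left 1)"
    using l(1) d by (intro tendsto_divide tendsto_const) auto
  ultimately have "lly_curvature V E w x y = l / ?d"
    unfolding lly_curvature_def by (simp add: tendsto_Lim)
  then have eq: "lly_curvature V E w x y * ?d = l" using d by simp
  \<comment> \<open>At \<open>\<alpha> = 0\<close> the quotient has denominator 1, so the bound of
    the Wasserstein distance by the total weight applies directly.\<close>
  show "?d - sum w E \<le> lly_curvature V E w x y * ?d"
    using l(2) walk_dist_bounds(2)[OF xy, of 0] unfolding eq by simp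
  show "lly_curvature V E w x y * ?d \<le> 2 * ?d"
    using l(3) unfolding eq .
qed

end

section \<open>The flow\<close>

text \<open>The bounds range over all edge sets and weights because both change along the flow.
  Symmetry makes \<open>on_edge\<close> well defined for \<open>K\<close>.\<close>

locale bounded_curvature =
  fixes V :: "'a set" and K :: "'a set set \<Rightarrow> ('a set \<Rightarrow> real) \<Rightarrow> 'a \<Rightarrow> 'a \<Rightarrow> real" and c :: real
  assumes c_ge_1: "1 \<le> c"
    and K_sym: "K E w x y = K E w y x"
    and K_ge: "weighted_graph V E w \<Longrightarrow> {x, y} \<in> E \<Longrightarrow>
      path_dist E w x y - sum w E \<le> K E w x y * path_dist E w x y"
    and K_le: "weighted_graph V E w \<Longrightarrow> {x, y} \<in> E \<Longrightarrow>
      K E w x y * path_dist E w x y \<le> c * path_dist E w x y"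

lemma bounded_curvature_ollivier:
  assumes "0 \<le> \<alpha>" "\<alpha> \<le> 1"
  shows "bounded_curvature V (ollivier_curvature V \<alpha>) 1"
proof
  fix E w x y assume "weighted_graph V E w" and xy: "{x, y} \<in> E"
  then interpret weighted_graph V E w by simp
  note eq = ollivier_curvature_times_dist[OF xy] and bounds = walk_dist_bounds[OF xy assms]
  show "path_dist E w x y - sum w E \<le> ollivier_curvature V \<alpha> E w x y * path_dist E w x y"
    using bounds(2) unfolding eq by simp
  show "ollivier_curvature V \<alpha> E w x y * path_dist E w x y \<le> 1 * path_dist E w x y"
    using bounds(1) unfolding eq by simp
qed (simp_all add: ollivier_curvature_sym[of V])

lemma bounded_curvature_lly: "bounded_curvature V (lly_curvature V) 2"
  by unfold_locales
    (simp_all add: lly_curvature_sym[of V] weighted_graph.lly_curvature_bounds)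

section \<open>Estimates for one step, then for the iterated flow\<close>

context bounded_curvature
begin

lemma flow_step_eq:
  assumes "{x, y} \<in> E"
  shows "flow_step K s E w {x, y} = path_dist E w x y - s * (K E w x y * path_dist E w x y)"
  using assms by (simp add: flow_step_def on_edge_doubleton path_dist_sym K_sym[of E w x y])

lemma flow_step_ge:
  assumes "weighted_graph V E w" "{x, y} \<in> E" "0 \<le> s"
  shows "(1 - c * s) * path_dist E w x y \<le> flow_step K s E w {x, y}"
  using mult_left_mono[OF K_le[OF assms(1,2)] assms(3)]
  by (simp add: flow_step_eq[OF assms(2)] algebra_simps)

lemma flow_step_pos:
  assumes "weighted_graph V E w" "e \<in> E" "0 \<le> s" "c * s < 1"
  shows "0 < flow_step K s E w e"
proof -
  interpret weighted_graph V E w by fact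
  obtain x y where e: "e = {x, y}" using edge_doubleton assms(2) .
  have "0 < (1 - c * s) * path_dist E w x y"
    using assms path_dist_pos edge_vertices[of x y] e by (intro mult_pos_pos) auto
  also have "\<dots> \<le> flow_step K s E w e"
    unfolding e by (rule flow_step_ge) (use assms e in auto)
  finally show ?thesis .
qed

text \<open>The lower curvature bound gives at most
  \<open>\<rho> - s * \<rho> + s * sum w E\<close>; the term \<open>- s * \<rho>\<close> is dropped
  and \<rho> is at most the weight of the edge.\<close>

lemma flow_step_le:
  assumes "weighted_graph V E w" "e \<in> E" "0 \<le> s"
  shows "flow_step K s E w e \<le> w e + s * sum w E"
proof -
  interpret weighted_graph V E w by fact
  obtain x y where e: "e = {x, y}" using edge_doubleton assms(2) .
  have xy: "{x, y} \<in> E" using assms e by simp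
  have "s * (path_dist E w x y - sum w E) \<le> s * (K E w x y * path_dist E w x y)"
    using K_ge[OF assms(1) xy] assms(3) by (rule mult_left_mono)
  moreover have "0 \<le> s * path_dist E w x y"
    using assms(3) path_dist_nonneg edge_vertices[OF xy] by simp
  ultimately show ?thesis
    using path_dist_le_weight[OF xy] unfolding e flow_step_eq[OF xy] by (simp add: algebra_simps)
qed

text \<open>The bound for a single edge involves the total weight, so it is the total that obeys a
  closed recursion.\<close>

lemma sum_flow_step_le:
  assumes "weighted_graph V E w" "0 \<le> s"
  shows "sum (flow_step K s E w) E \<le> (1 + real (card E) * s) * sum w E"
proof -
  have "sum (flow_step K s E w) E \<le> (\<Sum>e\<in>E. w e + s * sum w E)"
    using flow_step_le[OF assms(1) _ assms(2)] by (rule sum_mono)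
  also have "\<dots> = (1 + real (card E) * s) * sum w E"
    by (simp add: sum.distrib algebra_simps)
  finally show ?thesis .
qed

text \<open>The recursion determines the sequence; existence amounts to positivity, which lets every
  step be followed by another.\<close>

lemma ex1_ricci_flow_solution:
  assumes graph: "finite_connected_graph V E" and w0: "\<forall>e\<in>E. 0 < w0 e" and s: "0 \<le> s" "c * s < 1"
  shows "\<exists>!w. ricci_flow_solution K s E w0 w"
proof
  \<comment> \<open>The initial vector is restricted because \<open>w0\<close> is arbitrary outside
    \<open>E\<close>, whereas solutions are extensional.\<close>
  define w where "w = rec_nat (restrict w0 E) (\<lambda>_. flow_step K s E)"
  have w_0: "w 0 = restrict w0 E" and w_Suc: "w (Suc j) = flow_step K s E (w j)" for j
    by (simp_all add: w_def)
  have "w j \<in> E \<rightarrow>\<^sub>E {0<..}" for j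
  proof (induction j)
    case 0
    then show ?case using w0 by (auto simp: w_0)
  next
    case (Suc j)
    then have "weighted_graph V E (w j)"
      using graph by unfold_locales auto
    then show ?case
      using flow_step_pos[OF _ _ s] by (auto simp: w_Suc flow_step_def)
  qed
  then show "ricci_flow_solution K s E w0 w"
    by (simp add: ricci_flow_solution_def w_0 w_Suc)
  fix v assume v: "ricci_flow_solution K s E w0 v"
  have w_ext: "w j \<in> extensional E" for j
    by (cases j) (simp_all add: w_0 w_Suc flow_step_def)
  have v_ext: "v j \<in> extensional E" for j
    using v by (auto simp: ricci_flow_solution_def PiE_def)
  have "v j = w j" for j
  proof (induction j)
    case 0
    show ?case
      using v by (intro extensionalityI[OF v_ext w_ext]) (simp add: ricci_flow_solution_def w_0)
  next
    case (Suc j)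
    then show ?case
      using v by (intro extensionalityI[OF v_ext w_ext]) (simp add: ricci_flow_solution_def w_Suc)
  qed
  then show "v = w" by blast
qed

text \<open>One induction carries all claims, as each step needs the positivity from the previous
  one. The set \<open>F\<close> is the one before the surgery of iteration \<open>j\<close>, so
  exactly \<open>j\<close> surgeries have been performed, whence the exponent of \<theta>.\<close>

lemma surgery_state_bounds:
  assumes graph: "finite_connected_graph V E" and w0: "\<forall>e\<in>E. 0 < w0 e"
    and s: "0 \<le> s" "c * s < 1" and \<theta>: "1 \<le> \<theta>"
    and state: "surgery_state K s \<theta> E w0 j = (F, w)"
  shows "weighted_graph V F w" "F \<subseteq> E"
    and "e \<in> F \<Longrightarrow> (1 - c * s) ^ j / \<theta> ^ j * w0 e \<le> w e"
    and "sum w F \<le> (1 + c * real (card E) * s) ^ j * sum w0 E"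
proof -
  let ?C = "1 + c * real (card E) * s"
  have "weighted_graph V F w \<and> F \<subseteq> E \<and>
      (\<forall>e\<in>F. (1 - c * s) ^ j / \<theta> ^ j * w0 e \<le> w e) \<and> sum w F \<le> ?C ^ j * sum w0 E"
    using state
  proof (induction j arbitrary: F w)
    case 0
    then show ?case using graph w0 by (auto intro: weighted_graph.intro)
  next
    case (Suc j)
    obtain F0 v where state0: "surgery_state K s \<theta> E w0 j = (F0, v)" by fastforce
    then have F: "F = surgery \<theta> F0 v" and w: "w = flow_step K s F v"
      using Suc.prems by (auto simp: Let_def)
    from Suc.IH[OF state0] have F0: "weighted_graph V F0 v" "F0 \<subseteq> E"
      and lower: "\<And>e. e \<in> F0 \<Longrightarrow> (1 - c * s) ^ j / \<theta> ^ j * w0 e \<le> v e"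
      and upper: "sum v F0 \<le> ?C ^ j * sum w0 E" by auto
    interpret F0: weighted_graph V F0 v by fact
    have sub: "F \<subseteq> F0" using F0.surgery_subset F by simp
    interpret F: weighted_graph V F v
      using F0.finite_connected_graph_surgery[OF \<theta>] F F0.weight_pos sub by unfold_locales auto
    have finE: "finite E" using graph
      by (auto simp: finite_connected_graph_def intro: finite_subset[of _ "Pow V"])
    have "weighted_graph V F w"
      using F.graph flow_step_pos[OF F.weighted_graph_axioms _ s] w by unfold_locales auto
    moreover have "(1 - c * s) ^ Suc j / \<theta> ^ Suc j * w0 e \<le> w e" if e: "e \<in> F" for e
    proof -
      obtain x y where xy: "e = {x, y}" using F.edge_doubleton e .
      have "(1 - c * s) ^ Suc j / \<theta> ^ Suc j * w0 e
          = (1 - c * s) / \<theta> * ((1 - c * s) ^ j / \<theta> ^ j * w0 e)" by simp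
      also have "\<dots> \<le> (1 - c * s) / \<theta> * v e"
        using lower[of e] e sub s \<theta> by (intro mult_left_mono) auto
      \<comment> \<open>Since \<open>e\<close> survived the surgery, passing from weight to distance
        costs at most a factor \<theta>.\<close>
      also have "v e \<le> \<theta> * path_dist F v x y"
        using F0.weight_le_surgery_dist[OF \<theta>, of x y] e xy F by simp
      then have "(1 - c * s) / \<theta> * v e \<le> (1 - c * s) / \<theta> * (\<theta> * path_dist F v x y)"
        using s \<theta> by (intro mult_left_mono) auto
      also have "\<dots> = (1 - c * s) * path_dist F v x y" using \<theta> by simp
      also have "\<dots> \<le> w e"
        unfolding w xy by (rule flow_step_ge[OF F.weighted_graph_axioms _ s(1)]) (use e xy in simp)
      finally show ?thesis .
    qed
    moreover have "sum w F \<le> ?C ^ Suc j * sum w0 E"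
    proof -
      \<comment> \<open>One step yields the factor \<open>1 + real (card F) * s\<close>; it is
        enlarged to a constant that is the same for all iterations.\<close>
      have "1 * (real (card F) * s) \<le> c * (real (card E) * s)"
        using c_ge_1 s(1) sub F0(2) finE by (intro mult_mono) (auto intro!: mult_right_mono card_mono)
      then have C: "1 + real (card F) * s \<le> ?C" by (simp add: mult.assoc)
      have C0: "0 \<le> ?C" using c_ge_1 s(1) by simp
      have "sum w F \<le> (1 + real (card F) * s) * sum v F"
        unfolding w by (rule sum_flow_step_le[OF F.weighted_graph_axioms s(1)])
      also have "\<dots> \<le> ?C * sum v F"
        using C F.weight_pos by (intro mult_right_mono sum_nonneg) (auto intro: less_imp_le)
      also have "\<dots> \<le> ?C * sum v F0"
        using C0 sub F0.finite_E F0.weight_pos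
        by (intro mult_left_mono sum_mono2) (auto intro: less_imp_le)
      also have "\<dots> \<le> ?C * (?C ^ j * sum w0 E)"
        using C0 upper by (rule mult_left_mono[rotated])
      finally show ?thesis by (simp add: mult.assoc)
    qed
    ultimately show ?case using sub F0(2) by blast
  qed
  then show "weighted_graph V F w" "F \<subseteq> E" "sum w F \<le> ?C ^ j * sum w0 E"
    and "e \<in> F \<Longrightarrow> (1 - c * s) ^ j / \<theta> ^ j * w0 e \<le> w e" by auto
qed

text \<open>The edges remaining at iteration \<open>j\<close> have passed one more surgery than the
  set in state \<open>j\<close>, hence lie in it. By positivity a single weight is at most the
  total.\<close>

lemma surgery_weights_bounds:
  assumes graph: "finite_connected_graph V E" and w0: "\<forall>e\<in>E. 0 < w0 e"
    and s: "0 \<le> s" "c * s < 1" and \<theta>: "1 \<le> \<theta>"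
    and e: "e \<in> remaining_edges K s \<theta> E w0 j"
  shows "(1 - c * s) ^ j / \<theta> ^ j * w0 e \<le> surgery_weights K s \<theta> E w0 j e"
    and "surgery_weights K s \<theta> E w0 j e \<le> (1 + c * real (card E) * s) ^ j * sum w0 E"
proof -
  obtain F w where state: "surgery_state K s \<theta> E w0 j = (F, w)" by fastforce
  note bounds = surgery_state_bounds[OF graph w0 s \<theta> state]
  interpret weighted_graph V F w by (rule bounds)
  have w: "surgery_weights K s \<theta> E w0 j = w"
    using state by (simp add: surgery_weights_def)
  have eF: "e \<in> F"
    using e state by (auto simp: remaining_edges_def Let_def surgery_def)
  show "(1 - c * s) ^ j / \<theta> ^ j * w0 e \<le> surgery_weights K s \<theta> E w0 j e"
    unfolding w using bounds(3) eF .
  have "w e \<le> sum w F"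
    by (rule member_le_sum) (use eF finite_E weight_pos in \<open>auto intro: less_imp_le\<close>)
  then show "surgery_weights K s \<theta> E w0 j e \<le> (1 + c * real (card E) * s) ^ j * sum w0 E"
    unfolding w using bounds(4) by linarith
qed

end

theorem theorem2p5:
  fixes V :: "'a set" and E :: "'a set set" and w0 :: "'a set \<Rightarrow> real" and \<theta> :: real
  assumes "\<theta> > 1"
    and "finite_connected_graph V E"
    and "E \<noteq> {}"
    and "\<forall>e\<in>E. w0 e > 0"
  shows
    "(\<forall>\<alpha> s. 0 \<le> \<alpha> \<and> \<alpha> \<le> 1 \<and> 0 < s \<and> s < 1 \<longrightarrow>
        (\<exists>!w. ricci_flow_solution (ollivier_curvature V \<alpha>) s E w0 w) \<and>
        (\<forall>j. \<forall>e\<in>remaining_edges (ollivier_curvature V \<alpha>) s \<theta> E w0 j.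
           (1 - s) ^ j / \<theta> ^ j * w0 e \<le> surgery_weights (ollivier_curvature V \<alpha>) s \<theta> E w0 j e \<and>
           surgery_weights (ollivier_curvature V \<alpha>) s \<theta> E w0 j e
             \<le> (1 + real (card E) * s) ^ j * (\<Sum>\<tau>\<in>E. w0 \<tau>))) \<and>
     (\<forall>s. 0 < s \<and> s < 1/2 \<longrightarrow>
        (\<exists>!w. ricci_flow_solution (lly_curvature V) s E w0 w) \<and>
        (\<forall>j. \<forall>e\<in>remaining_edges (lly_curvature V) s \<theta> E w0 j.
           (1 - 2 * s) ^ j / \<theta> ^ j * w0 e \<le> surgery_weights (lly_curvature V) s \<theta> E w0 j e \<and>
           surgery_weights (lly_curvature V) s \<theta> E w0 j e
             \<le> (1 + 2 * real (card E) * s) ^ j * (\<Sum>\<tau>\<in>E. w0 \<tau>)))"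
proof (intro conjI allI impI ballI; elim conjE)
  fix \<alpha> s :: real
  assume \<alpha>: "0 \<le> \<alpha>" "\<alpha> \<le> 1" and s: "0 < s" "s < 1"
  interpret bounded_curvature V "ollivier_curvature V \<alpha>" 1
    by (rule bounded_curvature_ollivier[OF \<alpha>])
  show "\<exists>!w. ricci_flow_solution (ollivier_curvature V \<alpha>) s E w0 w"
    using ex1_ricci_flow_solution[OF assms(2,4)] s by simp
  fix j e assume e: "e \<in> remaining_edges (ollivier_curvature V \<alpha>) s \<theta> E w0 j"
  note bounds = surgery_weights_bounds[OF assms(2,4) _ _ _ e]
  show "(1 - s) ^ j / \<theta> ^ j * w0 e \<le> surgery_weights (ollivier_curvature V \<alpha>) s \<theta> E w0 j e"
    using bounds(1) s assms(1) by simp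
  show "surgery_weights (ollivier_curvature V \<alpha>) s \<theta> E w0 j e
      \<le> (1 + real (card E) * s) ^ j * (\<Sum>\<tau>\<in>E. w0 \<tau>)"
    using bounds(2) s assms(1) by simp
next
  fix s :: real
  assume s: "0 < s" "s < 1/2"
  \<comment> \<open>With \<open>c = 2\<close> the condition \<open>c * s < 1\<close> becomes
    \<open>s < 1/2\<close>.\<close>
  interpret bounded_curvature V "lly_curvature V" 2
    by (rule bounded_curvature_lly)
  show "\<exists>!w. ricci_flow_solution (lly_curvature V) s E w0 w"
    using ex1_ricci_flow_solution[OF assms(2,4)] s by simp
  fix j e assume e: "e \<in> remaining_edges (lly_curvature V) s \<theta> E w0 j"
  note bounds = surgery_weights_bounds[OF assms(2,4) _ _ _ e]
  show "(1 - 2 * s) ^ j / \<theta> ^ j * w0 e \<le> surgery_weights (lly_curvature V) s \<theta> E w0 j e"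
    using bounds(1) s assms(1) by simp
  show "surgery_weights (lly_curvature V) s \<theta> E w0 j e
      \<le> (1 + 2 * real (card E) * s) ^ j * (\<Sum>\<tau>\<in>E. w0 \<tau>)"
    using bounds(2) s assms(1) by simp
qed

end
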